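(* Let $f\colon I\to I$ be a tent map of slope $\lambda\in(\sqrt2,2)$ on its dynamical interval $I=[a,b]$, with turning point $c$ and kneading sequence $\kappa=\kappa(f)$. Let $S\in\{0,1\}^{\mathbb Z}$. Then $S\in J_f$ (i.e. $S$ is an itinerary of some point of the inverse limit $\widehat I$) if and only if the following three conditions hold: (A) $\overrightarrow{\sigma^r(S)}\preceq\kappa$ for all $r\in\mathbb Z$; (B) $S$ does not start $0^\infty$; and (C) if $c$ is periodic and $\overrightarrow{\sigma^r(S)}=\kappa$ for some $r\in\mathbb Z$, then $S_{r-1}=\varepsilon(f)$.
   Context: **Tent maps.** $I=[a,b]$ is a compact interval and $f\colon I\to I$ is a (continuous) tent map of slope $\lambda\in(\sqrt2,2)$: there is $c\in(a,b)$ such that $f$ has constant slope $\lambda$ on $[a,c]$ and constant slope $-\lambda$ on $[c,b]$. $I$ is the dynamical interval (core) of $f$: $f(c)=b$ and $f(b)=a$. **Sequences.** $\mathbb N=\{0,1,2,\dots\}$. $\sigma$ denotes the shift map on $\{0,1\}^{\mathbb Z}$: $\sigma(S)_i=S_{i+1}$. For $S\in\{0,1\}^{\mathbb Z}$, define $\overrightarrow S,\overleftarrow S\in\{0,1\}^{\mathbb N}$ by $\overrightarrow S_r=S_r$ and $\overleftarrow S_r=S_{-1-r}$ for $r\ge0$; so $\overrightarrow{\sigma^r(S)}=S_rS_{r+1}\ldots$. $S$ *does not start $0^\infty$* if infinitely many entries of $\overleftarrow S$ are $1$. A word is even (odd) if it contains an even (odd) number of $1$s. **Unimodal order.** For distinct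 $s,t\in\{0,1\}^{\mathbb N}$, $s\prec t$ iff the word $s_0\ldots s_r$ is even, where $r\ge0$ is least with $s_r\ne t_r$. $\preceq$ is the corresponding non-strict order. **Itineraries and kneading sequence.** If $c$ is periodic of period $n$, let $\varepsilon(f)=0$ (resp. $1$) if an even (resp. odd) number of the points $f^r(c)$, $1\le r<n$, lie in $(c,b]$; the itinerary $j(x)\in\{0,1\}^{\mathbb N}$ of $x\in I$ has $j(x)_r=0$, $1$, or $\varepsilon(f)$ according as $f^r(x)\in[a,c)$, $f^r(x)\in(c,b]$, or $f^r(x)=c$; and $\kappa(f)=j(b)$. If $c$ is not periodic, $s\in\{0,1\}^{\mathbb N}$ is an itinerary of $x\in I$ if $f^r(x)\in[a,c]$ whenever $s_r=0$ and $f^r(x)\in[c,b]$ whenever $s_r=1$; and $\kappa(f)$ is the (unique) itinerary of $b$. **Inverse limit.** $\widehat I=\{\mathbf x\in I^{\mathbb Z}: f(x_r)=x_{r+1}\text{ for all }r\in\mathbb Z\}$. If $c$ is periodic, the unique itinerary $J(\mathbf x)\in\{0,1\}^{\mathbb Z}$ of $\mathbf x\in\widehat I$ has $J(\mathbf x)_r=0$, $1$, or $\varepsilon(f)$ according as $x_r\in[a,c)$, $x_r\in(c,b]$, or $x_r=c$. If $c$ is not periodic, $S\in\{0,1\}^{\mathbb Z}$ is an itinerary of $\mathbf x$ if $x_r\in[a,c]$ whenever $S_r=0$ and $x_r\in[c,b]$ whenever $S_r=1$. $J_f\subset\{0,1\}^{\mathbb Z}$ is the set of all itineraries of points of $\widehat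 I$. *)

theory Defs
  imports "HOL-Analysis.Analysis" "HOL-Library.Z2"
begin

text \<open>
  Symbols are elements of the two-element type \<^typ>\<open>bit\<close>. A map \<open>f : I \<rightarrow> I\<close> with
  \<open>I = [a,b]\<close> is a total function on the reals of which only the restriction to \<open>{a..b}\<close> matters.
\<close>

definition tent_map :: "real \<Rightarrow> real \<Rightarrow> real \<Rightarrow> real \<Rightarrow> (real \<Rightarrow> real) \<Rightarrow> bool" where
  "tent_map a b c l f \<longleftrightarrow>
     a < c \<and> c < b \<and> f ` {a..b} \<subseteq> {a..b} \<and> continuous_on {a..b} f \<and>
     (\<forall>x\<in>{a..c}. \<forall>y\<in>{a..c}. f y - f x = l * (y - x)) \<and>
     (\<forall>x\<in>{c..b}. \<forall>y\<in>{c..b}. f y - f x = - l * (y - x)) \<and>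
     f c = b \<and> f b = a"

definition periodic_point :: "('a \<Rightarrow> 'a) \<Rightarrow> 'a \<Rightarrow> bool" where
  "periodic_point f x \<longleftrightarrow> (\<exists>n>0. (f ^^ n) x = x)"

definition least_period :: "('a \<Rightarrow> 'a) \<Rightarrow> 'a \<Rightarrow> nat" where
  "least_period f x = (LEAST n. n > 0 \<and> (f ^^ n) x = x)"

text \<open>Meaningful only if \<open>c\<close> is periodic.\<close>

definition eps :: "real \<Rightarrow> real \<Rightarrow> (real \<Rightarrow> real) \<Rightarrow> bit" where
  "eps b c f =
     (if even (card {r. 1 \<le> r \<and> r < least_period f c \<and> (f ^^ r) c \<in> {c<..b}}) then 0 else 1)"

text \<open>
  The symbol \<open>i\<close> is admissible for the point \<open>y\<close> of \<open>{a..b}\<close>. It is unique if \<open>c\<close> is periodic;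
  otherwise both symbols are admissible for \<open>c\<close>.
\<close>

definition codes :: "real \<Rightarrow> real \<Rightarrow> real \<Rightarrow> (real \<Rightarrow> real) \<Rightarrow> real \<Rightarrow> bit \<Rightarrow> bool" where
  "codes a b c f y i \<longleftrightarrow>
     (if periodic_point f c
      then (y \<in> {a..<c} \<and> i = 0) \<or> (y \<in> {c<..b} \<and> i = 1) \<or> (y = c \<and> i = eps b c f)
      else (i = 0 \<longrightarrow> y \<in> {a..c}) \<and> (i = 1 \<longrightarrow> y \<in> {c..b}))"

definition is_itinerary ::
    "real \<Rightarrow> real \<Rightarrow> real \<Rightarrow> (real \<Rightarrow> real) \<Rightarrow> real \<Rightarrow> (nat \<Rightarrow> bit) \<Rightarrow> bool" where
  "is_itinerary a b c f x s \<longleftrightarrow> (\<forall>r. codes a b c f ((f ^^ r) x) (s r))"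

definition kneading :: "real \<Rightarrow> real \<Rightarrow> real \<Rightarrow> (real \<Rightarrow> real) \<Rightarrow> nat \<Rightarrow> bit" where
  "kneading a b c f = (THE s. is_itinerary a b c f b s)"

definition inverse_limit :: "real \<Rightarrow> real \<Rightarrow> (real \<Rightarrow> real) \<Rightarrow> (int \<Rightarrow> real) set" where
  "inverse_limit a b f = {x. (\<forall>r. x r \<in> {a..b}) \<and> (\<forall>r. f (x r) = x (r + 1))}"

definition is_bi_itinerary ::
    "real \<Rightarrow> real \<Rightarrow> real \<Rightarrow> (real \<Rightarrow> real) \<Rightarrow> (int \<Rightarrow> real) \<Rightarrow> (int \<Rightarrow> bit) \<Rightarrow> bool" where
  "is_bi_itinerary a b c f x S \<longleftrightarrow> (\<forall>r. codes a b c f (x r) (S r))"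

definition itineraries :: "real \<Rightarrow> real \<Rightarrow> real \<Rightarrow> (real \<Rightarrow> real) \<Rightarrow> (int \<Rightarrow> bit) set" where
  "itineraries a b c f = {S. \<exists>x\<in>inverse_limit a b f. is_bi_itinerary a b c f x S}"

text \<open>The shift \<open>\<sigma>\<close> is invertible; \<open>shift r\<close> is its integer power \<open>\<sigma>\<^sup>r\<close>.\<close>

definition shift :: "int \<Rightarrow> (int \<Rightarrow> 'a) \<Rightarrow> int \<Rightarrow> 'a" where
  "shift r S = (\<lambda>i. S (i + r))"

lemma shift_0: "shift 0 S = S"
  by (simp add: shift_def)

lemma shift_add: "shift (r + s) S = shift r (shift s S)"
  by (simp add: shift_def add.assoc)

definition forward_seq :: "(int \<Rightarrow> 'a) \<Rightarrow> nat \<Rightarrow> 'a" where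
  "forward_seq S r = S (int r)"

definition backward_seq :: "(int \<Rightarrow> 'a) \<Rightarrow> nat \<Rightarrow> 'a" where
  "backward_seq S r = S (-1 - int r)"

definition starts_zeros :: "(int \<Rightarrow> bit) \<Rightarrow> bool" where
  "starts_zeros S \<longleftrightarrow> finite {r. backward_seq S r = 1}"

definition even_word :: "bit list \<Rightarrow> bool" where
  "even_word w \<longleftrightarrow> even (count_list w 1)"

definition unimodal_less :: "(nat \<Rightarrow> bit) \<Rightarrow> (nat \<Rightarrow> bit) \<Rightarrow> bool" where
  "unimodal_less s t \<longleftrightarrow>
     (\<exists>r. s r \<noteq> t r \<and> (\<forall>i<r. s i = t i) \<and> even_word (map s [0..<Suc r]))"

definition unimodal_le :: "(nat \<Rightarrow> bit) \<Rightarrow> (nat \<Rightarrow> bit) \<Rightarrow> bool" where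
  "unimodal_le s t \<longleftrightarrow> s = t \<or> unimodal_less s t"

text \<open>The description defining \<^const>\<open>kneading\<close> is proper.\<close>

lemma kneading_unique:
  assumes "tent_map a b c l f"
  shows "\<exists>!s. is_itinerary a b c f b s"
proof -
  have ord: "a < c" "c < b" and fc: "f c = b" and inv: "\<And>x. x \<in> {a..b} \<Longrightarrow> f x \<in> {a..b}"
    using assms unfolding tent_map_def by blast+
  have orb: "(f ^^ r) b \<in> {a..b}" for r
    by (induction r) (use ord inv in auto)
  have nc: "(f ^^ r) b \<noteq> c" if "\<not> periodic_point f c" for r
  proof
    assume "(f ^^ r) b = c"
    then have "(f ^^ Suc r) c = c" by (simp only: funpow_Suc_right o_apply fc)
    with that show False unfolding periodic_point_def by blast
  qed
  have "\<exists>!i. codes a b c f ((f ^^ r) b) i" for r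
    using orb[of r] nc[of r] ord
    by (intro ex1I[of _ "if (f ^^ r) b < c then 0 else if c < (f ^^ r) b then 1 else eps b c f"])
       (auto simp: codes_def split: if_splits)
  then obtain s where s: "\<And>r. codes a b c f ((f ^^ r) b) (s r)"
    and u: "\<And>r i. codes a b c f ((f ^^ r) b) i \<Longrightarrow> i = s r"
    by metis
  show ?thesis
    by (rule ex1I[of _ s]) (auto simp: is_itinerary_def s intro: u)
qed

lemma kneading_is_itinerary:
  "tent_map a b c l f \<Longrightarrow> is_itinerary a b c f b (kneading a b c f)"
  unfolding kneading_def by (rule theI'[OF kneading_unique])

end

theory Submission
  imports Defs
begin

text \<open>
  Write \<open>\<epsilon>\<close> for the sign \<open>1\<close> or \<open>-1\<close> of the slope on the branch with a given symbol. A point \<open>y\<close> of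
  \<open>[a,b]\<close> that carries the symbol \<open>i\<close> satisfies \<open>y = c + \<epsilon>(i) (f y - b) / l\<close>: the symbol selects the
  inverse branch. Iterating this relation shows that \<open>y\<close> is the sum of a series that depends only on
  the itinerary \<open>s\<close> of \<open>y\<close>. The series converges for \<^emph>\<open>every\<close> sequence \<open>s\<close>, because \<open>l > 1\<close>, and its
  sum is here called the \<^emph>\<open>address\<close> of \<open>s\<close>. The whole theorem comes from one identity
  (\<open>address_diff\<close>): if \<open>s\<close> precedes \<open>t\<close> in the unimodal order, with first difference at \<open>r\<close>, then
  the difference of the addresses of \<open>t\<close> and \<open>s\<close> is \<open>l\<close> to the power \<open>-(r+1)\<close> times the sum of the
  amounts, possibly negative, by which the addresses of the tails of \<open>s\<close> and \<open>t\<close> after position \<open>r\<close>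
  stay below \<open>b\<close>.

  For the necessity of the three conditions, let \<open>S\<close> be an itinerary of \<open>x\<close>. If some forward sequence
  of \<open>S\<close> exceeded the kneading sequence, then the identity would force the corresponding \<open>x\<^sub>r\<close> to be
  at least \<open>b\<close>, hence equal to \<open>b\<close>, whose itinerary is unique. A left tail of zeros is impossible
  since \<open>f y - y\<close> is bounded below by \<open>(2 - l) (b - a) > 0\<close> on the left branch. If a forward sequence
  is the kneading sequence, then \<open>x\<^sub>r = b\<close>, so that \<open>x\<close> visits \<open>c\<close>, the only preimage of \<open>b\<close>, one
  step earlier.

  For their sufficiency, let \<open>x\<^sub>r\<close> be the address of the forward sequence of \<open>S\<close> from \<open>r\<close>. The point
  is to show that \<open>x\<^sub>r\<close> lies in \<open>[a,b]\<close>. The identity, applied with the kneading sequence as \<open>t\<close>,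
  shows that an excess over \<open>b\<close> propagates to a later tail and grows there by a factor of at least
  \<open>l\<close>; as addresses are bounded, no excess exists (\<open>address_le\<close>). The lower bound \<open>a\<close> holds right
  after each symbol \<open>1\<close>, by the upper bound for the point that carries this symbol, and it passes on
  to all later points because \<open>f\<close> maps \<open>[a,b]\<close> to itself. As \<open>S\<close> has no left tail of zeros, there is a
  symbol \<open>1\<close> before every position. If \<open>c\<close> is periodic, it remains
  to see that \<open>S\<close> has the symbol prescribed for \<open>c\<close> whenever \<open>x\<^sub>r = c\<close>. Then \<open>x\<close> is \<open>b\<close> one
  step later, and the forward sequence from there must be the kneading sequence: a smaller sequence
  with address \<open>b\<close> could leave the kneading sequence only at a visit to \<open>c\<close>, where the parity
  convention that defines \<^const>\<open>eps\<close> makes it larger instead (\<open>eq_kneading_if_address_eq\<close>).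
\<close>


section \<open>Parity of words as a product of signs\<close>

definition branch_sign :: "bit \<Rightarrow> real" where
  "branch_sign i = (if i = 0 then 1 else - 1)"

lemma branch_sign_simps [simp]: "branch_sign 0 = 1" "branch_sign 1 = - 1"
  by (simp_all add: branch_sign_def)

lemma abs_branch_sign [simp]: "\<bar>branch_sign i\<bar> = 1"
  by (simp add: branch_sign_def)

lemma branch_sign_neq: "i \<noteq> j \<Longrightarrow> branch_sign j = - branch_sign i"
  by (cases i; cases j) auto

lemma prod_branch_sign:
  "(\<Prod>i<n. branch_sign (s i)) = (if even_word (map s [0..<n]) then 1 else - 1)"
proof (induction n)
  case 0
  then show ?case by (simp add: even_word_def)
next
  case (Suc n)
  then show ?case by (cases "s n") (auto simp: even_word_def)
qed

lemma even_word_iff_prod: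
  "even_word (map s [0..<n]) \<longleftrightarrow> (\<Prod>i<n. branch_sign (s i)) = 1"
  by (simp add: prod_branch_sign)


section \<open>Bounded sequences under expansion\<close>

text \<open>A positive \<open>d 0\<close> would make \<open>d\<close> grow like \<open>l ^ n\<close>.\<close>

lemma bounded_expanding_nonpos:
  fixes d :: "nat \<Rightarrow> real"
  assumes "1 < l" and bound: "\<And>n. d n \<le> K" and expand: "\<And>n. l * d n \<le> d (Suc n)"
  shows "d 0 \<le> 0"
proof (rule ccontr)
  assume "\<not> d 0 \<le> 0"
  then have pos: "0 < d 0" by simp
  have "l ^ n * d 0 \<le> d n" for n
  proof (induction n)
    case (Suc n)
    have "l ^ Suc n * d 0 \<le> l * d n"
      using Suc \<open>1 < l\<close> by simp
    then show ?case using expand[of n] by linarith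
  qed simp
  moreover obtain n where "K / d 0 < l ^ n"
    using real_arch_pow[OF \<open>1 < l\<close>] by blast
  then have "K < l ^ n * d 0"
    using pos by (simp add: field_simps)
  ultimately show False using bound[of n] by (meson not_le order_trans)
qed


section \<open>Tent maps and the address of a symbol sequence\<close>

locale expanding_tent =
  fixes a b c l :: real and f :: "real \<Rightarrow> real"
  assumes slope_gt: "1 < l" and slope_lt: "l < 2" and tent: "tent_map a b c l f"
begin

abbreviation "kappa \<equiv> kneading a b c f"

lemma c_between: "a < c" "c < b"
  and f_c: "f c = b" and f_b: "f b = a"
  and f_range: "y \<in> {a..b} \<Longrightarrow> f y \<in> {a..b}"
  using tent unfolding tent_map_def by blast+

lemma f_left: "y \<in> {a..c} \<Longrightarrow> f y = b - l * (c - y)"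
proof -
  assume "y \<in> {a..c}"
  moreover have "c \<in> {a..c}" using c_between by simp
  ultimately have "f c - f y = l * (c - y)"
    using tent unfolding tent_map_def by blast
  then show ?thesis using f_c by simp
qed

lemma f_right: "y \<in> {c..b} \<Longrightarrow> f y = b - l * (y - c)"
proof -
  assume "y \<in> {c..b}"
  moreover have "c \<in> {c..b}" using c_between by simp
  ultimately have "f y - f c = - l * (y - c)"
    using tent unfolding tent_map_def by blast
  then show ?thesis using f_c by simp
qed

lemma b_minus_a: "b - a = l * (b - c)"
  using f_right[of b] f_b c_between by simp

lemma f_eq_b: "y \<in> {a..b} \<Longrightarrow> f y = b \<Longrightarrow> y = c"
  using f_left[of y] f_right[of y] slope_gt by (cases "y \<le> c") auto

lemma funpow_range: "y \<in> {a..b} \<Longrightarrow> (f ^^ n) y \<in> {a..b}"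
  using f_range by (induction n) auto

lemma funpow_b: "(f ^^ n) b = (f ^^ Suc n) c"
  by (simp only: funpow_Suc_right o_apply f_c)

text \<open>The fixed point of the affine extension of the left branch lies strictly to the left of \<open>a\<close>.\<close>

lemma left_branch_gap: "y \<in> {a..c} \<Longrightarrow> y + (2 - l) * (b - a) \<le> f y"
proof -
  assume y: "y \<in> {a..c}"
  have "f y - y - (2 - l) * (b - a) = (l - 1) * (y - a)"
    unfolding f_left[OF y] using b_minus_a by (simp add: algebra_simps)
  moreover have "0 \<le> (l - 1) * (y - a)" using y slope_gt by simp
  ultimately show ?thesis by linarith
qed

lemma codes_side: "codes a b c f y i \<Longrightarrow> y \<in> (if i = 0 then {a..c} else {c..b})"
  using c_between by (cases i) (auto simp: codes_def split: if_splits)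

lemma codes_inverse_branch:
  "codes a b c f y i \<Longrightarrow> y = c + branch_sign i / l * (f y - b)"
  using codes_side[of y i] f_left[of y] f_right[of y] slope_gt
  by (cases i) (auto simp: field_simps)

lemma inverse_branch_codes_weakly:
  assumes "y = c + branch_sign i / l * (z - b)" "z \<le> b" "y \<in> {a..b}"
  shows "y \<in> (if i = 0 then {a..c} else {c..b})" "f y = z"
proof -
  have "(z - b) / l \<le> 0"
    using assms(2) slope_gt by (simp add: divide_nonpos_pos)
  then show side: "y \<in> (if i = 0 then {a..c} else {c..b})"
    using assms by (cases i) auto
  moreover have "l * (y - c) = branch_sign i * (z - b)"
    using assms(1) slope_gt by simp
  ultimately show "f y = z"
    using f_left[of y] f_right[of y] by (cases i) (simp_all add: right_diff_distrib)
qed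

lemma codes_if_neq_c:
  "y \<in> (if i = 0 then {a..c} else {c..b}) \<Longrightarrow> y \<noteq> c \<Longrightarrow> codes a b c f y i"
  by (cases i) (auto simp: codes_def)

text \<open>This series is the formal solution of
  \<open>address s = c + branch_sign (s 0) / l * (address (tail of s) - b)\<close>.\<close>

definition address :: "(nat \<Rightarrow> bit) \<Rightarrow> real" where
  "address s = c - (b - c) * (\<Sum>n. \<Prod>i\<le>n. branch_sign (s i) / l)"

lemma address_term_abs: "\<bar>\<Prod>i\<le>n. branch_sign (s i) / l\<bar> = (1 / l) ^ Suc n"
  using slope_gt by (simp add: abs_prod)

lemma summable_bound: "summable (\<lambda>n. (1 / l) ^ Suc n)"
  using slope_gt by (subst summable_Suc_iff) (auto intro: summable_geometric)

lemma summable_address: "summable (\<lambda>n. \<Prod>i\<le>n. branch_sign (s i) / l)"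
  by (rule summable_comparison_test'[OF summable_bound, of 0])
     (simp add: address_term_abs[unfolded power_Suc] del: prod.atMost_Suc)

lemma address_step:
  "address s = c + branch_sign (s 0) / l * (address (\<lambda>i. s (Suc i)) - b)"
proof -
  let ?g = "branch_sign (s 0) / l"
  let ?t = "\<lambda>n. \<Prod>i\<le>n. branch_sign (s i) / l"
  let ?u = "\<lambda>n. \<Prod>i\<le>n. branch_sign (s (Suc i)) / l"
  have "?t (Suc n) = ?g * ?u n" for n
    by (rule prod.atMost_Suc_shift)
  then have "(\<Sum>n. ?t (Suc n)) = ?g * (\<Sum>n. ?u n)"
    using suminf_mult[OF summable_address, of ?g "\<lambda>i. s (Suc i)"] by presburger
  moreover have "(\<Sum>n. ?t (Suc n)) = (\<Sum>n. ?t n) - ?g"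
    using suminf_split_head[OF summable_address, of s] by simp
  ultimately have "(\<Sum>n. ?t n) = ?g + ?g * (\<Sum>n. ?u n)"
    by simp
  moreover have "c - (b - c) * (g + g * u) = c + g * (c - (b - c) * u - b)" for g u
    by (simp add: algebra_simps)
  ultimately show ?thesis
    unfolding address_def by presburger
qed

lemma address_bounded: "\<exists>K. \<forall>s. \<bar>address s\<bar> \<le> K"
proof -
  let ?B = "\<Sum>n. (1 / l) ^ Suc n"
  have "\<bar>address s\<bar> \<le> \<bar>c\<bar> + \<bar>b - c\<bar> * ?B" for s :: "nat \<Rightarrow> bit"
  proof -
    have "\<bar>\<Sum>n. \<Prod>i\<le>n. branch_sign (s i) / l\<bar> \<le> (\<Sum>n. \<bar>\<Prod>i\<le>n. branch_sign (s i) / l\<bar>)"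
      by (rule summable_rabs) (subst address_term_abs, rule summable_bound)
    then have "\<bar>\<Sum>n. \<Prod>i\<le>n. branch_sign (s i) / l\<bar> \<le> ?B"
      by (subst (asm) address_term_abs)
    then have "\<bar>b - c\<bar> * \<bar>\<Sum>n. \<Prod>i\<le>n. branch_sign (s i) / l\<bar> \<le> \<bar>b - c\<bar> * ?B"
      by (intro mult_left_mono) auto
    then show ?thesis
      using abs_triangle_ineq4[of c "(b - c) * (\<Sum>n. \<Prod>i\<le>n. branch_sign (s i) / l)"]
      unfolding address_def abs_mult by linarith
  qed
  then show ?thesis by blast
qed

text \<open>Two bounded solutions of the recursion differ by a bounded sequence that expands by the
  factor \<open>l\<close>, hence agree. In particular an itinerary determines its point.\<close>

lemma address_unique:
  assumes rec: "\<And>n. y n = c + branch_sign (s n) / l * (y (Suc n) - b)"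
    and bound: "\<And>n. y n \<in> {a..b}"
  shows "y 0 = address s"
proof -
  obtain K where K: "\<And>s. \<bar>address s\<bar> \<le> K" using address_bounded by blast
  define d where "d n = \<bar>y n - address (\<lambda>i. s (n + i))\<bar>" for n
  have "l * d n = d (Suc n)" for n
  proof -
    have "y n - address (\<lambda>i. s (n + i)) =
        branch_sign (s n) / l * (y (Suc n) - address (\<lambda>i. s (Suc n + i)))"
      unfolding rec[of n] address_step[of "\<lambda>i. s (n + i)"]
      by (simp add: right_diff_distrib diff_divide_distrib)
    then show ?thesis
      using slope_gt unfolding d_def by (simp add: abs_mult)
  qed
  moreover have "d n \<le> \<bar>a\<bar> + \<bar>b\<bar> + K" for n
    using K[of "\<lambda>i. s (n + i)"] bound[of n] unfolding d_def by auto
  ultimately have "d 0 \<le> 0"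
    using bounded_expanding_nonpos[OF slope_gt] by (metis order_refl)
  then show ?thesis by (simp add: d_def)
qed

lemma address_itinerary:
  assumes "is_itinerary a b c f y s" "y \<in> {a..b}"
  shows "address s = y"
  using address_unique[of "\<lambda>n. (f ^^ n) y" s] assms funpow_range
    codes_inverse_branch by (simp add: is_itinerary_def)

lemma kappa: "is_itinerary a b c f b kappa"
  using kneading_is_itinerary[OF tent] .

lemma kappa_codes: "codes a b c f ((f ^^ n) b) (kappa n)"
  using kappa by (simp add: is_itinerary_def)

lemma kappa_unique: "is_itinerary a b c f b s \<Longrightarrow> s = kappa"
  using kneading_unique[OF tent] kappa by blast

lemma is_itinerary_shift:
  "is_itinerary a b c f y s \<Longrightarrow> is_itinerary a b c f ((f ^^ n) y) (\<lambda>i. s (i + n))"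
  unfolding is_itinerary_def by (metis funpow_add o_apply)

lemma address_kappa_shift: "address (\<lambda>i. kappa (i + n)) = (f ^^ n) b"
  using address_itinerary[OF is_itinerary_shift[OF kappa]] funpow_range[of b] c_between by simp

lemma address_kappa: "address kappa = b"
  using address_kappa_shift[of 0] by simp


section \<open>Addresses and the unimodal order\<close>

lemma address_common_prefix:
  assumes "\<forall>i<r. s i = t i"
  shows "address t - address s =
    (\<Prod>i<r. branch_sign (s i)) / l ^ r * (address (\<lambda>i. t (i + r)) - address (\<lambda>i. s (i + r)))"
  using assms
proof (induction r)
  case (Suc r)
  let ?t = "\<lambda>n. address (\<lambda>i. t (i + n))" and ?s = "\<lambda>n. address (\<lambda>i. s (i + n))"
  have "?t r = c + branch_sign (s r) / l * (?t (Suc r) - b)"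
    using Suc.prems by (subst address_step) simp
  moreover have "?s r = c + branch_sign (s r) / l * (?s (Suc r) - b)"
    by (subst address_step) simp
  ultimately have "?t r - ?s r = branch_sign (s r) / l * (?t (Suc r) - ?s (Suc r))"
    by (simp add: right_diff_distrib diff_divide_distrib)
  then show ?case using Suc by (simp add: mult.commute mult.left_commute)
qed simp

text \<open>At the first difference the two sequences select opposite inverse branches, which meet at \<open>c\<close>.
  The parity in the unimodal order is exactly what turns both contributions into the
  same sign.\<close>

lemma address_diff:
  assumes "s r \<noteq> t r" "\<forall>i<r. s i = t i" "even_word (map s [0..<Suc r])"
  shows "l ^ Suc r * (address t - address s) =
    (b - address (\<lambda>i. t (i + Suc r))) + (b - address (\<lambda>i. s (i + Suc r)))"
proof -
  let ?P = "\<Prod>i<r. branch_sign (s i)" and ?e = "branch_sign (s r)"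
  let ?t = "\<lambda>n. address (\<lambda>i. t (i + n))" and ?s = "\<lambda>n. address (\<lambda>i. s (i + n))"
  have "?t r = c + branch_sign (t r) / l * (?t (Suc r) - b)"
    and "?s r = c + ?e / l * (?s (Suc r) - b)"
    by (subst address_step; simp)+
  then have "?t r - ?s r = ?e / l * ((b - ?t (Suc r)) + (b - ?s (Suc r)))"
    unfolding branch_sign_neq[OF assms(1)]
    by (simp add: distrib_left right_diff_distrib diff_divide_distrib add_divide_distrib)
  then have "address t - address s =
      (?P * ?e) / l ^ Suc r * ((b - ?t (Suc r)) + (b - ?s (Suc r)))"
    using address_common_prefix[OF assms(2)] by (simp add: mult.assoc mult.commute[of l])
  moreover have "?P * ?e = 1"
    using assms(3) unfolding even_word_iff_prod by simp
  ultimately show ?thesis using slope_gt by simp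
qed

text \<open>Words that differ only in the last symbol have opposite parities, so exactly one of two
  distinct sequences has an even word up to the first difference.\<close>

lemma unimodal_less_total:
  assumes "\<not> unimodal_le s t"
  shows "unimodal_less t s"
proof -
  have "s \<noteq> t" using assms by (auto simp: unimodal_le_def)
  then obtain n where n: "s n \<noteq> t n" by auto
  define r where "r = (LEAST n. s n \<noteq> t n)"
  have r: "s r \<noteq> t r" "\<forall>i<r. s i = t i"
    unfolding r_def using LeastI[of "\<lambda>n. s n \<noteq> t n", OF n] not_less_Least by blast+
  have "\<not> even_word (map s [0..<Suc r])"
    using assms r unfolding unimodal_le_def unimodal_less_def by blast
  moreover have "(\<Prod>i<Suc r. branch_sign (t i)) = - (\<Prod>i<Suc r. branch_sign (s i))"
    using r branch_sign_neq[OF r(1)] by simp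
  ultimately have "even_word (map t [0..<Suc r])"
    unfolding prod_branch_sign by (simp split: if_splits)
  then show ?thesis
    using r unfolding unimodal_less_def by metis
qed

text \<open>All points involved lie in \<open>[a,b]\<close>, so the right-hand side of \<open>address_diff\<close> is nonnegative: an
  itinerary above the kneading sequence would belong to a point not below \<open>b\<close>.\<close>

lemma itinerary_le_kappa:
  assumes s: "is_itinerary a b c f y s" and y: "y \<in> {a..b}"
  shows "unimodal_le s kappa"
proof (rule ccontr)
  assume "\<not> unimodal_le s kappa"
  then obtain r where r: "kappa r \<noteq> s r" "\<forall>i<r. kappa i = s i"
      "even_word (map kappa [0..<Suc r])"
    using unimodal_less_total unfolding unimodal_less_def by blast
  have "address (\<lambda>i. s (i + Suc r)) = (f ^^ Suc r) y"
    by (rule address_itinerary[OF is_itinerary_shift[OF s] funpow_range[OF y]])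
  moreover have "(f ^^ Suc r) y \<le> b" "(f ^^ Suc r) b \<le> b"
    using funpow_range[of _ "Suc r"] y c_between by auto
  ultimately have "0 \<le> l ^ Suc r * (y - b)"
    using address_diff[OF r] address_itinerary[OF s y] address_kappa
      address_kappa_shift[of "Suc r"] by simp
  moreover have "0 < l ^ Suc r"
    using slope_gt by simp
  ultimately have "\<not> y - b < 0"
    using mult_pos_neg by (meson not_le)
  then have "s = kappa"
    using s y kappa_unique[of s] by simp
  then show False using r by simp
qed

text \<open>If \<open>s\<close> first leaves the kneading sequence at \<open>r\<close>, then an excess of the address of \<open>s\<close> over
  \<open>b\<close> reappears, multiplied by at least \<open>l ^ Suc r\<close>, in the tail after \<open>r\<close>. The bound is
  proved by induction on the number of times that this happens.\<close>

lemma address_le: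
  assumes "\<forall>n. unimodal_le (\<lambda>i. s (i + n)) kappa"
  shows "address s \<le> b"
proof -
  obtain K where K: "\<And>s. \<bar>address s\<bar> \<le> K" using address_bounded by blast
  define C where "C = K + \<bar>b\<bar>"
  have "0 \<le> C" using K[of s] by (simp add: C_def)
  have bound: "l ^ k * (address s - b) \<le> C" if "\<forall>n. unimodal_le (\<lambda>i. s (i + n)) kappa" for k s
    using that
  proof (induction k arbitrary: s)
    case 0
    then show ?case using K[of s] by (simp add: C_def)
  next
    case (Suc k)
    show ?case
    proof (cases "address s \<le> b")
      case True
      then have "l ^ Suc k * (address s - b) \<le> 0"
        using slope_gt by (intro mult_nonneg_nonpos) auto
      then show ?thesis using \<open>0 \<le> C\<close> by linarith
    next
      case False
      then have "s \<noteq> kappa" using address_kappa by auto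
      then have "unimodal_less s kappa"
        using spec[OF Suc.prems, of 0] by (simp add: unimodal_le_def)
      then obtain r where r: "s r \<noteq> kappa r" "\<forall>i<r. s i = kappa i"
          "even_word (map s [0..<Suc r])"
        unfolding unimodal_less_def by blast
      let ?s = "\<lambda>i. s (i + Suc r)"
      have "(f ^^ Suc r) b \<le> b"
        using funpow_range[of b "Suc r"] c_between by auto
      then have "l ^ Suc r * (address s - b) \<le> address ?s - b"
        using address_diff[OF r] address_kappa address_kappa_shift[of "Suc r"]
        by (simp add: algebra_simps)
      moreover have "l * (address s - b) \<le> l ^ Suc r * (address s - b)"
        using False slope_gt by (intro mult_right_mono) (auto simp: self_le_power)
      ultimately have "l * (address s - b) \<le> address ?s - b"
        by linarith
      then have "l ^ k * (l * (address s - b)) \<le> l ^ k * (address ?s - b)"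
        using slope_gt by (intro mult_left_mono) auto
      moreover have "unimodal_le (\<lambda>i. ?s (i + n)) kappa" for n
        using spec[OF Suc.prems, of "n + Suc r"] by (simp add: add.assoc)
      then have "l ^ k * (address ?s - b) \<le> C"
        by (intro Suc.IH) blast
      ultimately show ?thesis by (simp add: mult.assoc mult.left_commute)
    qed
  qed
  have "l * (l ^ k * (address s - b)) \<le> l ^ Suc k * (address s - b)" for k
    by simp
  then have "l ^ 0 * (address s - b) \<le> 0"
    using bounded_expanding_nonpos[OF slope_gt, of "\<lambda>k. l ^ k * (address s - b)" C]
      bound[OF assms] by blast
  then show ?thesis by simp
qed


section \<open>Parity of the kneading sequence when the turning point is periodic\<close>

lemma least_period:
  assumes "periodic_point f c"
  shows "0 < least_period f c" "(f ^^ least_period f c) c = c"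
    and "\<And>m. 0 < m \<Longrightarrow> (f ^^ m) c = c \<Longrightarrow> least_period f c \<le> m"
  using LeastI_ex[OF assms[unfolded periodic_point_def]]
  by (auto simp: least_period_def intro: Least_le)

text \<open>The last symbol of the first period is the one attached to \<open>c\<close>, and \<^const>\<open>eps\<close> is the parity of
  the symbols before it.\<close>

lemma kappa_period_even:
  assumes per: "periodic_point f c"
  shows "(\<Prod>i<least_period f c. branch_sign (kappa i)) = 1"
proof -
  obtain m where m: "least_period f c = Suc m"
    using least_period(1)[OF per] gr0_conv_Suc by blast
  define R where "R = {i. i < m \<and> (f ^^ i) b \<in> {c<..b}}"
  have sign: "branch_sign (kappa i) = (if i \<in> R then - 1 else 1)" if "i < m" for i
  proof -
    have "(f ^^ i) b \<noteq> c"
    proof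
      assume "(f ^^ i) b = c"
      then have "(f ^^ Suc i) c = c" by (simp only: funpow_b)
      then have "Suc m \<le> Suc i" using least_period(3)[OF per, of "Suc i"] m by simp
      then show False using that by simp
    qed
    then show ?thesis
      using kappa_codes[of i] that per by (auto simp: codes_def R_def)
  qed
  have "(\<Prod>i<m. branch_sign (kappa i)) = (\<Prod>i<m. if i \<in> R then - 1 else 1)"
    by (rule prod.cong) (auto simp: sign)
  also have "\<dots> = (- 1) ^ card R"
  proof -
    have "{..<m} \<inter> R = R" by (auto simp: R_def)
    then show ?thesis
      using prod.inter_restrict[of "{..<m}" "\<lambda>_. - 1 :: real" R] by simp
  qed
  also have "card R = card {r. 1 \<le> r \<and> r < least_period f c \<and> (f ^^ r) c \<in> {c<..b}}"
  proof (rule bij_betw_same_card[of Suc])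
    have "{r. 1 \<le> r \<and> r < least_period f c \<and> (f ^^ r) c \<in> {c<..b}} = Suc ` R"
    proof (intro equalityI subsetI)
      fix r assume r: "r \<in> {r. 1 \<le> r \<and> r < least_period f c \<and> (f ^^ r) c \<in> {c<..b}}"
      then obtain i where i: "r = Suc i" by (cases r) auto
      have "i \<in> R" using r unfolding i R_def m funpow_b by simp
      then show "r \<in> Suc ` R" using i by blast
    next
      fix r assume "r \<in> Suc ` R"
      then obtain i where i: "r = Suc i" "i \<in> R" by blast
      then show "r \<in> {r. 1 \<le> r \<and> r < least_period f c \<and> (f ^^ r) c \<in> {c<..b}}"
        unfolding R_def m funpow_b by simp
    qed
    then show "bij_betw Suc R {r. 1 \<le> r \<and> r < least_period f c \<and> (f ^^ r) c \<in> {c<..b}}"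
      by (simp add: bij_betw_def)
  qed
  also have "(- 1) ^ \<dots> = branch_sign (eps b c f)"
    by (simp add: eps_def)
  finally have "(\<Prod>i<m. branch_sign (kappa i)) = branch_sign (eps b c f)" .
  moreover have "kappa m = eps b c f"
  proof -
    have "(f ^^ m) b = c"
      using least_period(2)[OF per] by (simp only: m funpow_b)
    then show ?thesis
      using kappa_codes[of m] per by (simp add: codes_def)
  qed
  ultimately show ?thesis
    unfolding m by (simp add: branch_sign_def)
qed

text \<open>The kneading sequence is invariant under the shift by the least period, so a return of \<open>b\<close>
  can be peeled off one even period at a time.\<close>

lemma kappa_return_even:
  assumes per: "periodic_point f c"
  shows "(f ^^ m) b = b \<Longrightarrow> (\<Prod>i<m. branch_sign (kappa i)) = 1"
proof (induction m rule: less_induct)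
  case (less m)
  define p where "p = least_period f c"
  show ?case
  proof (cases "m = 0")
    case False
    have "f ((f ^^ m) c) = b"
      using less.prems funpow_b[of m] by simp
    moreover have "(f ^^ m) c \<in> {a..b}"
      using funpow_range[of c m] c_between by simp
    ultimately have "(f ^^ m) c = c"
      by (rule f_eq_b[rotated])
    then have "p \<le> m"
      using least_period(3)[OF per] False by (simp add: p_def)
    then obtain q where q: "m = q + p"
      by (metis le_add_diff_inverse2)
    have pb: "(f ^^ p) b = b"
      using least_period(2)[OF per] funpow_b[of p] f_c by (simp add: p_def)
    have shift: "kappa (i + p) = kappa i" for i
    proof -
      have "is_itinerary a b c f b (\<lambda>i. kappa (i + p))"
        using is_itinerary_shift[OF kappa, of p] pb by simp
      then show ?thesis
        using fun_cong[OF kappa_unique] by metis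
    qed
    have "(f ^^ q) b = b"
      using less.prems pb unfolding q by (simp add: funpow_add)
    moreover have "q < m" using least_period(1)[OF per] by (simp add: q p_def)
    ultimately have "(\<Prod>i<q. branch_sign (kappa i)) = 1"
      using less.IH by blast
    moreover have "(\<Prod>i<m. branch_sign (kappa i)) =
        (\<Prod>i<p. branch_sign (kappa i)) * (\<Prod>i<q. branch_sign (kappa i))"
      unfolding q by (induction q) (simp_all add: shift)
    ultimately show ?thesis
      using kappa_period_even[OF per] by (simp add: p_def)
  qed simp
qed

text \<open>If \<open>s\<close> is strictly below the kneading sequence with the same address \<open>b\<close>, then both terms in
  \<open>address_diff\<close> vanish. So the kneading orbit is back at \<open>b\<close> right after the first difference, and
  by parity the common prefix followed by the symbol of \<open>s\<close> is an odd word.\<close>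

lemma eq_kneading_if_address_eq:
  assumes per: "periodic_point f c"
    and le: "\<forall>n. unimodal_le (\<lambda>i. s (i + n)) kappa" and addr: "address s = b"
  shows "s = kappa"
proof (rule ccontr)
  assume "s \<noteq> kappa"
  then have "unimodal_less s kappa"
    using spec[OF le, of 0] by (simp add: unimodal_le_def)
  then obtain r where r: "s r \<noteq> kappa r" "\<forall>i<r. s i = kappa i"
      "even_word (map s [0..<Suc r])"
    unfolding unimodal_less_def by blast
  have "unimodal_le (\<lambda>i. s (i + Suc r + n)) kappa" for n
    using spec[OF le, of "n + Suc r"] by (simp add: ac_simps)
  then have "address (\<lambda>i. s (i + Suc r)) \<le> b"
    by (intro address_le) (simp add: ac_simps)
  moreover have "(f ^^ Suc r) b \<le> b"
    using funpow_range[of b "Suc r"] c_between by auto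
  ultimately have "(f ^^ Suc r) b = b"
    using address_diff[OF r] address_kappa addr address_kappa_shift[of "Suc r"] by simp
  then have "(\<Prod>i<Suc r. branch_sign (kappa i)) = 1"
    by (rule kappa_return_even[OF per])
  moreover have "(\<Prod>i<Suc r. branch_sign (s i)) = - (\<Prod>i<Suc r. branch_sign (kappa i))"
    using r(2) branch_sign_neq[OF r(1)] by simp
  ultimately show False
    using r(3) unfolding even_word_iff_prod by simp
qed


section \<open>Itineraries in the inverse limit\<close>

lemma forward_seq_shift: "forward_seq (shift r S) n = S (r + int n)"
  by (simp add: forward_seq_def shift_def add.commute)

lemma forward_seq_tail:
  "(\<lambda>i. forward_seq (shift r S) (i + n)) = forward_seq (shift (r + int n) S)"
  by (rule ext) (simp add: forward_seq_shift ac_simps)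

lemma forward_seq_Suc:
  "(\<lambda>i. forward_seq (shift r S) (Suc i)) = forward_seq (shift (r + 1) S)"
  using forward_seq_tail[of r S 1] by simp

lemma not_starts_zeros_iff: "\<not> starts_zeros S \<longleftrightarrow> (\<forall>r. \<exists>k<r. S k = 1)"
proof -
  have "\<not> starts_zeros S \<longleftrightarrow> (\<forall>m. \<exists>n\<ge>m. S (- 1 - int n) = 1)"
    by (simp add: starts_zeros_def infinite_nat_iff_unbounded_le backward_seq_def)
  also have "\<dots> \<longleftrightarrow> (\<forall>r. \<exists>k<r. S k = 1)"
  proof (intro iffI allI)
    fix r :: int assume "\<forall>m. \<exists>n\<ge>m. S (- 1 - int n) = 1"
    then obtain n where n: "n \<ge> nat (- r)" "S (- 1 - int n) = 1" by blast
    then show "\<exists>k<r. S k = 1" by (intro exI[of _ "- 1 - int n"]) auto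
  next
    fix m :: nat assume "\<forall>r. \<exists>k<r. S k = 1"
    then obtain k where k: "k < - int m" "S k = 1" by blast
    then show "\<exists>n\<ge>m. S (- 1 - int n) = 1" by (intro exI[of _ "nat (- 1 - k)"]) auto
  qed
  finally show ?thesis .
qed

context
  fixes x :: "int \<Rightarrow> real" and S :: "int \<Rightarrow> bit"
  assumes x: "x \<in> inverse_limit a b f" and S: "is_bi_itinerary a b c f x S"
begin

lemma x_range: "x r \<in> {a..b}" and f_x: "f (x r) = x (r + 1)"
  using x by (auto simp: inverse_limit_def)

lemma x_codes: "codes a b c f (x r) (S r)"
  using S by (simp add: is_bi_itinerary_def)

lemma x_itinerary: "is_itinerary a b c f (x r) (forward_seq (shift r S))"
proof -
  have "(f ^^ n) (x r) = x (r + int n)" for n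
    by (induction n) (simp_all add: f_x ac_simps)
  then show ?thesis
    using x_codes by (simp add: is_itinerary_def forward_seq_shift)
qed

text \<open>Going back along zeros decreases the coordinate by at least a fixed amount at each step.\<close>

lemma itinerary_not_starts_zeros: "\<not> starts_zeros S"
  unfolding not_starts_zeros_iff
proof (rule ccontr)
  assume "\<not> (\<forall>r. \<exists>k<r. S k = 1)"
  then obtain r where r: "\<And>k. k < r \<Longrightarrow> S k = 0"
    by (metis bit_not_one_iff)
  define g where "g = (2 - l) * (b - a)"
  have "0 < g" using slope_lt c_between by (simp add: g_def)
  have "x (r - int n) + real n * g \<le> x r" for n
  proof (induction n)
    case (Suc n)
    have "x (r - int (Suc n)) \<in> {a..c}"
      using codes_side[OF x_codes[of "r - int (Suc n)"]] r by simp
    from left_branch_gap[OF this]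
    have "x (r - int (Suc n)) + g \<le> x (r - int n)"
      using f_x[of "r - int (Suc n)"] by (simp add: g_def)
    then show ?case using Suc by (simp add: algebra_simps)
  qed simp
  then have "real n * g \<le> b - a" for n
    using x_range[of "r - int n"] x_range[of r] by (smt (verit) atLeastAtMost_iff)
  moreover obtain n where "b - a < real n * g"
    using reals_Archimedean3[OF \<open>0 < g\<close>] by blast
  ultimately show False by (meson not_le)
qed

lemma itinerary_before_kneading:
  assumes "periodic_point f c" "forward_seq (shift r S) = kappa"
  shows "S (r - 1) = eps b c f"
proof -
  have "x r = b"
    using address_itinerary[OF x_itinerary x_range, of r] assms(2) address_kappa by simp
  then have "x (r - 1) = c"
    using f_eq_b[OF x_range] f_x[of "r - 1"] by simp
  then show ?thesis
    using x_codes[of "r - 1"] assms(1) by (simp add: codes_def)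
qed

end

lemma conditions_imp_itinerary:
  assumes A: "\<And>r. unimodal_le (forward_seq (shift r S)) kappa"
    and B: "\<not> starts_zeros S"
    and C: "\<And>r. periodic_point f c \<Longrightarrow> forward_seq (shift r S) = kappa \<Longrightarrow> S (r - 1) = eps b c f"
  shows "S \<in> itineraries a b c f"
proof -
  define x where "x r = address (forward_seq (shift r S))" for r
  have tails: "\<forall>n. unimodal_le (\<lambda>i. forward_seq (shift r S) (i + n)) kappa" for r
    using A by (simp add: forward_seq_tail)
  have rec: "x r = c + branch_sign (S r) / l * (x (r + 1) - b)" for r
    using address_step[of "forward_seq (shift r S)"]
    unfolding x_def forward_seq_Suc by (simp add: forward_seq_shift)
  have upper: "x r \<le> b" for r
    unfolding x_def using address_le[OF tails] .
  \<comment> \<open>Start right after a symbol \<open>1\<close>: there the bound says that the point carrying this \<open>1\<close> is at most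
    \<open>b\<close>. From then on \<open>f\<close> keeps the points in \<open>[a,b]\<close>.\<close>
  have lower: "a \<le> x r" for r
  proof -
    obtain k where k: "k < r" "S k = 1"
      using B unfolding not_starts_zeros_iff by blast
    have "k + 1 \<le> r" using k by simp
    then show ?thesis
    proof (induction r rule: int_ge_induct)
      case base
      have "x k = c + (b - x (k + 1)) / l"
        using rec[of k] k(2) by (simp add: diff_divide_distrib)
      then have "(b - x (k + 1)) / l \<le> b - c"
        using upper[of k] by simp
      then have "b - x (k + 1) \<le> l * (b - c)"
        using slope_gt by (simp add: field_simps)
      then show ?case using b_minus_a by linarith
    next
      case (step i)
      then have "x i \<in> {a..b}" using upper[of i] by simp
      moreover from this have "f (x i) = x (i + 1)"
        using inverse_branch_codes_weakly(2)[OF rec upper] by blast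
      ultimately show ?case using f_range[of "x i"] by simp
    qed
  qed
  have range: "x r \<in> {a..b}" for r
    using lower upper by simp
  note weak = inverse_branch_codes_weakly[OF rec upper range]
  have "x \<in> inverse_limit a b f"
    using range weak(2) by (simp add: inverse_limit_def)
  moreover have "codes a b c f (x r) (S r)" for r
  proof (cases "periodic_point f c \<and> x r = c")
    case True
    then have "address (forward_seq (shift (r + 1) S)) = b"
      using weak(2)[of r] f_c by (simp add: x_def)
    then have "forward_seq (shift (r + 1) S) = kappa"
      by (rule eq_kneading_if_address_eq[OF conjunct1[OF True] tails])
    then have "S r = eps b c f"
      using C[of "r + 1"] True by fastforce
    then show ?thesis using True by (simp add: codes_def)
  next
    case False
    then consider "x r \<noteq> c" | "x r = c" "\<not> periodic_point f c"
      by blast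
    then show ?thesis
    proof cases
      case 1
      then show ?thesis by (rule codes_if_neq_c[OF weak(1)])
    next
      case 2
      then show ?thesis using c_between by (simp add: codes_def)
    qed
  qed
  ultimately show ?thesis
    unfolding itineraries_def is_bi_itinerary_def by blast
qed

end

theorem lemma5:
  fixes a b c l :: real and f :: "real \<Rightarrow> real" and S :: "int \<Rightarrow> bit"
  assumes "sqrt 2 < l" and "l < 2"
    and "tent_map a b c l f"
  shows "S \<in> itineraries a b c f \<longleftrightarrow>
      (\<forall>r. unimodal_le (forward_seq (shift r S)) (kneading a b c f)) \<and>
      \<not> starts_zeros S \<and>
      (periodic_point f c \<longrightarrow>
        (\<forall>r. forward_seq (shift r S) = kneading a b c f \<longrightarrow> S (r - 1) = eps b c f))"
    (is "_ \<longleftrightarrow> ?conditions")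
proof -
  have "1 < l"
    using assms(1) real_sqrt_gt_1_iff[of 2] by linarith
  then interpret expanding_tent a b c l f
    using assms by unfold_locales
  show ?thesis
  proof
    assume "S \<in> itineraries a b c f"
    then obtain x where x: "x \<in> inverse_limit a b f" "is_bi_itinerary a b c f x S"
      by (auto simp: itineraries_def)
    show ?conditions
      using itinerary_le_kappa[OF x_itinerary[OF x] x_range[OF x]]
        itinerary_not_starts_zeros[OF x] itinerary_before_kneading[OF x] by blast
  next
    assume ?conditions
    then show "S \<in> itineraries a b c f"
      by (intro conditions_imp_itinerary) auto
  qed
qed

end
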